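(* Let $r>k\ge 1$ be integers and let $A\subseteq \mathbb{Z}/r\mathbb{Z}$ be nonempty and $k$-symmetric. Let $(W,R)$ be the Kripke frame with $W=\mathbb{Z}/r\mathbb{Z}$ and $R=\{(w,w+a)\mid w\in\mathbb{Z}/r\mathbb{Z},\ a\in A\}$. Then for every world $w\in\mathbb{Z}/r\mathbb{Z}$, every modal formula $\Phi$ and every valuation $V\subseteq \mathbb{Z}/r\mathbb{Z}$, with $M=(\mathbb{Z}/r\mathbb{Z},R,V)$ we have $M\vDash w:\Box\Diamond\Box\Phi$ if and only if $M\vDash w+k:\Box\Phi$.
   Context: $\mathbb{Z}/r\mathbb{Z}$ denotes the integers modulo $r$ with its usual addition; integers are identified with their residue classes. The set $A$ is called $k$-symmetric if for all $a\in A$, $k-a\in A$. Modal formulas are built from a single propositional variable $p$ by the operators $\Box,\Diamond$ (and negation $\lnot$). Kripke semantics: for a model $M=(W,R,V)$, $M\vDash w:p$ iff $w\in V$; $M\vDash w:\Box\Phi$ iff $M\vDash w':\Phi$ for all $w'$ with $(w,w')\in R$; $M\vDash w:\Diamond\Phi$ iff $M\vDash w':\Phi$ for some $w'$ with $(w,w')\in R$; $M\vDash w:\lnot\Phi$ iff $M\nvDash w:\Phi$. *)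

theory Defs
  imports "HOL-Algebra.Elementary_Groups"
begin

text \<open>
  \<^term>\<open>integer_mod_group r\<close> has carrier \<^term>\<open>{0..<int r}\<close> for \<^prop>\<open>r > 0\<close>; it is a
  multiplicatively written record, so its operation \<open>x \<otimes> y\<close> is addition modulo \<open>r\<close>, and
  \<open>x \<otimes> inv y\<close> is subtraction.
\<close>

abbreviation residue_class :: "nat \<Rightarrow> int \<Rightarrow> int" where
  "residue_class r z \<equiv> z mod int r"

definition k_symmetric :: "nat \<Rightarrow> int \<Rightarrow> int set \<Rightarrow> bool" where
  "k_symmetric r k A \<longleftrightarrow>
     (\<forall>a\<in>A. residue_class r k \<otimes>\<^bsub>integer_mod_group r\<^esub> inv\<^bsub>integer_mod_group r\<^esub> a \<in> A)"

datatype modal_formula =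
    Var
  | Neg modal_formula
  | Box modal_formula
  | Dia modal_formula

record 'w kripke_frame =
  worlds :: "'w set"
  access :: "('w \<times> 'w) set"

record 'w kripke_model = "'w kripke_frame" +
  valuation :: "'w set"

text \<open>
  As usual, the modal clauses range over successors only; in a frame with
  \<open>access M \<subseteq> worlds M \<times> worlds M\<close> these are worlds.
\<close>

primrec satisfies :: "'w kripke_model \<Rightarrow> 'w \<Rightarrow> modal_formula \<Rightarrow> bool" where
  "satisfies M w Var \<longleftrightarrow> w \<in> valuation M"
| "satisfies M w (Neg \<Phi>) \<longleftrightarrow> \<not> satisfies M w \<Phi>"
| "satisfies M w (Box \<Phi>) \<longleftrightarrow> (\<forall>w'. (w, w') \<in> access M \<longrightarrow> satisfies M w' \<Phi>)"
| "satisfies M w (Dia \<Phi>) \<longleftrightarrow> (\<exists>w'. (w, w') \<in> access M \<and> satisfies M w' \<Phi>)"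

definition cayley_access :: "nat \<Rightarrow> int set \<Rightarrow> (int \<times> int) set" where
  "cayley_access r A =
     {(w, w \<otimes>\<^bsub>integer_mod_group r\<^esub> a) | w a. w \<in> carrier (integer_mod_group r) \<and> a \<in> A}"

definition cayley_model :: "nat \<Rightarrow> int set \<Rightarrow> int set \<Rightarrow> int kripke_model" where
  "cayley_model r A V =
     \<lparr>worlds = carrier (integer_mod_group r), access = cayley_access r A, valuation = V\<rparr>"

lemma cayley_access_subset:
  assumes "A \<subseteq> carrier (integer_mod_group r)"
  shows "cayley_access r A \<subseteq> carrier (integer_mod_group r) \<times> carrier (integer_mod_group r)"
  using assms by (auto simp: cayley_access_def carrier_integer_mod_group)

end

theory Submission
  imports Defs
begin

text \<open>
  Reflecting a step \<open>a\<close> to \<open>k - a\<close> turns any two-step path \<open>a, k - a\<close> into a translation by \<open>k\<close>.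
  From right to left, the witness for the diamond after the step \<open>a\<close> is \<open>k - a\<close>.
  From left to right, if \<open>b\<close> is the witness after the step \<open>a\<close>, then the inner box is
  applied to the step \<open>k - b\<close>, and \<open>w + a + b + (k - b) = w + k + a\<close>.
\<close>

lemma (in comm_group) reflection_translate_iff:
  assumes A: "A \<subseteq> carrier G" and k: "k \<in> carrier G" and w: "w \<in> carrier G"
    and refl: "\<And>a. a \<in> A \<Longrightarrow> k \<otimes> inv a \<in> A"
  shows "(\<forall>a\<in>A. \<exists>b\<in>A. \<forall>c\<in>A. P (w \<otimes> a \<otimes> b \<otimes> c)) \<longleftrightarrow> (\<forall>a\<in>A. P (w \<otimes> k \<otimes> a))"
proof
  assume L: "\<forall>a\<in>A. \<exists>b\<in>A. \<forall>c\<in>A. P (w \<otimes> a \<otimes> b \<otimes> c)"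
  show "\<forall>a\<in>A. P (w \<otimes> k \<otimes> a)"
  proof
    fix a assume a: "a \<in> A"
    then obtain b where b: "b \<in> A" "P (w \<otimes> a \<otimes> b \<otimes> (k \<otimes> inv b))"
      using L refl by blast
    have ab: "a \<in> carrier G" "b \<in> carrier G" using A a b(1) by auto
    \<comment> \<open>The diamond gives no control over \<open>b\<close>, but \<open>b\<close> and
      its reflection always add up to \<open>k\<close>, so the unknown witness cancels.\<close>
    then have "b \<otimes> (k \<otimes> inv b) = k"
      using k by (simp add: m_lcomm[of b k])
    then have "w \<otimes> a \<otimes> b \<otimes> (k \<otimes> inv b) = w \<otimes> k \<otimes> a"
      using ab w k by (simp add: m_assoc m_comm[of a k])
    with b(2) show "P (w \<otimes> k \<otimes> a)" by simp
  qed
next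
  assume R: "\<forall>a\<in>A. P (w \<otimes> k \<otimes> a)"
  show "\<forall>a\<in>A. \<exists>b\<in>A. \<forall>c\<in>A. P (w \<otimes> a \<otimes> b \<otimes> c)"
  proof
    fix a assume a: "a \<in> A"
    then have ac: "a \<in> carrier G" using A by auto
    then have "a \<otimes> (k \<otimes> inv a) = k"
      using k by (simp add: m_lcomm[of a k])
    then have "w \<otimes> a \<otimes> (k \<otimes> inv a) = w \<otimes> k"
      using ac w k by (simp add: m_assoc)
    \<comment> \<open>With this witness the path has reached \<open>w \<otimes> k\<close>, so the
      remaining claim over all \<open>c\<close> is exactly \<open>R\<close>.\<close>
    then show "\<exists>b\<in>A. \<forall>c\<in>A. P (w \<otimes> a \<otimes> b \<otimes> c)"
      using R refl[OF a] by (intro bexI[of _ "k \<otimes> inv a"]) simp_all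
  qed
qed

text \<open>Successors are indexed by steps in \<open>A\<close>; the premise on \<open>u\<close>
  matters because \<open>cayley_access\<close> has no edges leaving a point outside the
  carrier.\<close>

lemma cayley_model_access_iff:
  assumes "u \<in> carrier (integer_mod_group r)"
  shows "(u, v) \<in> access (cayley_model r A V) \<longleftrightarrow> (\<exists>a\<in>A. v = u \<otimes>\<^bsub>integer_mod_group r\<^esub> a)"
  using assms by (auto simp: cayley_model_def cayley_access_def)

theorem theorem1:
  fixes r k :: nat and A V :: "int set" and w :: int and \<Phi> :: modal_formula
  assumes "r > k" and "k \<ge> 1"
    and "A \<subseteq> carrier (integer_mod_group r)" and "A \<noteq> {}"
    and "k_symmetric r (int k) A"
    and "w \<in> carrier (integer_mod_group r)"
    and "V \<subseteq> carrier (integer_mod_group r)"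
  shows "satisfies (cayley_model r A V) w (Box (Dia (Box \<Phi>)))
     \<longleftrightarrow> satisfies (cayley_model r A V) (w \<otimes>\<^bsub>integer_mod_group r\<^esub> residue_class r (int k)) (Box \<Phi>)"
proof -
  let ?G = "integer_mod_group r"
  let ?M = "cayley_model r A V"
  let ?k = "residue_class r (int k)"
  interpret comm_group ?G by (rule abelian_integer_mod_group)
  have k: "?k \<in> carrier ?G"
    using assms(1) by (simp add: carrier_integer_mod_group)
  have A: "a \<in> carrier ?G" if "a \<in> A" for a
    using assms(3) that by blast
  \<comment> \<open>Modal operators become quantifiers over steps, which brings the claim into the
    language of the group.\<close>
  have box: "satisfies ?M u (Box \<Psi>) \<longleftrightarrow> (\<forall>a\<in>A. satisfies ?M (u \<otimes>\<^bsub>?G\<^esub> a) \<Psi>)"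
    and dia: "satisfies ?M u (Dia \<Psi>) \<longleftrightarrow> (\<exists>a\<in>A. satisfies ?M (u \<otimes>\<^bsub>?G\<^esub> a) \<Psi>)"
    if "u \<in> carrier ?G" for u \<Psi>
    using cayley_model_access_iff[OF that] by auto
  \<comment> \<open>Closure keeps each intermediate point in the carrier, as \<open>box\<close> and
    \<open>dia\<close> require. The product must not unfold to addition modulo \<open>r\<close>, so
    that group laws still apply.\<close>
  have "satisfies ?M w (Box (Dia (Box \<Phi>))) \<longleftrightarrow>
      (\<forall>a\<in>A. \<exists>b\<in>A. \<forall>c\<in>A. satisfies ?M (w \<otimes>\<^bsub>?G\<^esub> a \<otimes>\<^bsub>?G\<^esub> b \<otimes>\<^bsub>?G\<^esub> c) \<Phi>)"
    using assms(6) A by (simp add: box dia m_closed del: satisfies.simps mult_integer_mod_group)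
  \<comment> \<open>Here \<open>P\<close> is the truth of \<open>\<Phi>\<close> as a predicate of
    the endpoint, arbitrary since \<open>V\<close> and \<open>\<Phi>\<close> are.\<close>
  also have "\<dots> \<longleftrightarrow> (\<forall>a\<in>A. satisfies ?M (w \<otimes>\<^bsub>?G\<^esub> ?k \<otimes>\<^bsub>?G\<^esub> a) \<Phi>)"
    using assms(5) unfolding k_symmetric_def
    by (intro reflection_translate_iff[OF assms(3) k assms(6)]) blast
  also have "\<dots> \<longleftrightarrow> satisfies ?M (w \<otimes>\<^bsub>?G\<^esub> ?k) (Box \<Phi>)"
    using box[OF m_closed[OF assms(6) k]] by blast
  finally show ?thesis .
qed

end
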